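(* For $m\ge1$ let $$p_m(y)=\sum_{k=1}^{m}y^k\,S(m,k)\,(-1)^{k-1}(k-1)!,$$ where $S(m,k)$ are the Stirling numbers of the second kind. Let $\alpha$ be an umbra, $n$ a positive integer and $1\le i\le n$. Then $$(\chi\boldsymbol{.}\alpha)^i\simeq\sum_{\lambda\vdash i}d_\lambda\,p_\lambda\!\left(\frac{\chi\boldsymbol{.}\chi}{n\boldsymbol{.}\chi}\right)(n\boldsymbol{.}\alpha)^{r_1}(n\boldsymbol{.}\alpha^2)^{r_2}\cdots,$$ where $\lambda=(1^{r_1},2^{r_2},\ldots)$ runs over the partitions of $i$ and $p_\lambda(y)=[p_1(y)]^{r_1}[p_2(y)]^{r_2}\cdots$.
   Context: Umbral calculus: $K$ is a field of characteristic zero, $A$ a set of symbols called umbrae, $E:K[A]\to K$ a linear functional with $E[1]=1$ and $E[\alpha^i\beta^j\cdots\gamma^k]=E[\alpha^i]E[\beta^j]\cdots E[\gamma^k]$ for distinct umbrae. The moments of $\alpha$ are $a_j=E[\alpha^j]$. For umbral polynomials, $p\simeq q$ means $E[p]=E[q]$; $p,q$ are uncorrelated if no umbra occurs in both; $p\equiv q$ (similar) means $E[p^j]=E[q^j]$ for all $j\ge0$. The alphabet is saturated: for every sequence $1,a_1,a_2,\dots$ there are infinitely many umbrae with these moments, and auxiliary umbrae are treated as elements of $A$. For $\lambda=(1^{r_1},2^{r_2},\ldots)\vdash i$ ($r_j$ parts equal to $j$), $\nu_\lambda=r_1+r_2+\cdots$ and $d_\lambda=\frac{i!}{r_1!r_2!\cdots(1!)^{r_1}(2!)^{r_2}\cdots}$.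 Also $(x)_m=x(x-1)\cdots(x-m+1)$. The singleton umbra $\chi$ has $E[\chi]=1$ and $E[\chi^j]=0$ for $j\ge2$. The dot product $\gamma\boldsymbol{.}\alpha$ is an umbra with $E[(\gamma\boldsymbol{.}\alpha)^i]=\sum_{\lambda\vdash i}E[(\gamma)_{\nu_\lambda}]\,d_\lambda\,a_1^{r_1}a_2^{r_2}\cdots$. In particular $E[(\chi\boldsymbol{.}\alpha)^i]=\sum_{\lambda\vdash i}(-1)^{\nu_\lambda-1}(\nu_\lambda-1)!\,d_\lambda a_1^{r_1}a_2^{r_2}\cdots$ is the $i$th cumulant of $\alpha$, and $E[(\chi\boldsymbol{.}\chi)^k]=(-1)^{k-1}(k-1)!$ for $k\ge1$. $n\boldsymbol{.}\chi$ is a sum of $n$ uncorrelated umbrae similar to $\chi$, so $E[(n\boldsymbol{.}\chi)^k]=(n)_k$. $1/(n\boldsymbol{.}\chi)$ denotes a multiplicative inverse of $n\boldsymbol{.}\chi$, with $k$th moment $1/(n)_k$; $\frac{\chi\boldsymbol{.}\chi}{n\boldsymbol{.}\chi}$ is its product with the uncorrelated umbra $\chi\boldsymbol{.}\chi$, so $E\bigl[\bigl(\frac{\chi\boldsymbol{.}\chi}{n\boldsymbol{.}\chi}\bigr)^k\bigr]=\frac{(-1)^{k-1}(k-1)!}{(n)_k}$ for $1\le k\le n$. In $p_\lambda\bigl(\frac{\chi\boldsymbol{.}\chi}{n\boldsymbol{.}\chi}\bigr)$ the polynomial $p_\lambda(y)$ is expanded first and then $y$ is replaced by this umbra (which is uncorrelated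 with the power sums). Power sums: fix uncorrelated umbrae $\alpha_1,\dots,\alpha_n$ similar to $\alpha$; $n\boldsymbol{.}\alpha^j$ denotes $\alpha_1^j+\cdots+\alpha_n^j$ (the same $\alpha_1,\dots,\alpha_n$ for all $j$). *)

theory Defs
  imports
    "HOL-Library.Poly_Mapping"
    "HOL-Library.Multiset"
    "HOL-Computational_Algebra.Polynomial"
    "HOL-Combinatorics.Stirling"
begin

section \<open>Umbral polynomials\<close>

text \<open>
  The alphabet \<open>A\<close> is the type \<open>'a\<close>. A monomial in the umbrae is a finitely supported
  map from umbrae to exponents, and \<open>K[A]\<close> is the corresponding monoid ring.
\<close>

type_synonym ('a, 'k) umbral_poly = "('a \<Rightarrow>\<^sub>0 nat) \<Rightarrow>\<^sub>0 'k"

definition Const :: "'k \<Rightarrow> ('a, 'k::zero) umbral_poly" where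
  "Const c = Poly_Mapping.single 0 c"

definition umb :: "'a \<Rightarrow> ('a, 'k::zero_neq_one) umbral_poly" where
  "umb \<alpha> = Poly_Mapping.single (Poly_Mapping.single \<alpha> 1) 1"

definition umbrae_in :: "('a, 'k::zero) umbral_poly \<Rightarrow> 'a set" where
  "umbrae_in p = (\<Union>m \<in> Poly_Mapping.keys p. Poly_Mapping.keys m)"

definition uncorrelated :: "('a, 'k::zero) umbral_poly \<Rightarrow> ('a, 'k) umbral_poly \<Rightarrow> bool" where
  "uncorrelated p q \<longleftrightarrow> umbrae_in p \<inter> umbrae_in q = {}"

locale umbral_calculus =
  fixes E :: "('a, 'k::field_char_0) umbral_poly \<Rightarrow> 'k"
  assumes E_add: "E (p + q) = E p + E q"
    and E_scale: "E (Const c * p) = c * E p"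
    and E_one: "E 1 = 1"
    and E_prod_distinct:
      "finite S \<Longrightarrow> E (\<Prod>\<alpha>\<in>S. umb \<alpha> ^ e \<alpha>) = (\<Prod>\<alpha>\<in>S. E (umb \<alpha> ^ e \<alpha>))"
    and saturated: "a 0 = 1 \<Longrightarrow> infinite {\<alpha>. \<forall>j. E (umb \<alpha> ^ j) = a j}"

definition umbral_equiv ::
  "(('a, 'k) umbral_poly \<Rightarrow> 'k) \<Rightarrow> ('a, 'k) umbral_poly \<Rightarrow> ('a, 'k) umbral_poly \<Rightarrow> bool" where
  "umbral_equiv E p q \<longleftrightarrow> E p = E q"

definition similar ::
  "(('a, 'k::comm_semiring_1) umbral_poly \<Rightarrow> 'k) \<Rightarrow>
    ('a, 'k) umbral_poly \<Rightarrow> ('a, 'k) umbral_poly \<Rightarrow> bool" where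
  "similar E p q \<longleftrightarrow> (\<forall>j. umbral_equiv E (p ^ j) (q ^ j))"


section \<open>Partitions of an integer\<close>

text \<open>
  A partition is the multiset of its (positive) parts. For \<open>\<mu> = (1\<^bsup>r\<^sub>1\<^esup>, 2\<^bsup>r\<^sub>2\<^esup>, \<dots>)\<close>
  one has \<open>r\<^sub>j = count \<mu> j\<close> and \<open>\<nu>\<^sub>\<mu> = size \<mu>\<close>; factors with \<open>r\<^sub>j = 0\<close> are trivial, so
  products over \<open>j\<close> range over \<open>set_mset \<mu>\<close>.
\<close>

definition int_partitions :: "nat \<Rightarrow> nat multiset set" where
  "int_partitions i = {\<mu>. 0 \<notin># \<mu> \<and> \<Sum>\<^sub># \<mu> = i}"

definition d_coeff :: "nat multiset \<Rightarrow> 'k::field_char_0" where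
  "d_coeff \<mu> = fact (\<Sum>\<^sub># \<mu>) /
     ((\<Prod>j\<in>set_mset \<mu>. fact (count \<mu> j)) * (\<Prod>j\<in>set_mset \<mu>. fact j ^ count \<mu> j))"

lemma finite_int_partitions: "finite (int_partitions i)"
proof (induction i rule: less_induct)
  case (less i)
  have "int_partitions i \<subseteq>
    insert {#} (\<Union>j\<in>{1..i}. add_mset j ` int_partitions (i - j))"
  proof
    fix \<mu> assume l: "\<mu> \<in> int_partitions i"
    show "\<mu> \<in> insert {#} (\<Union>j\<in>{1..i}. add_mset j ` int_partitions (i - j))"
    proof (cases \<mu>)
      case (add j \<kappa>)
      with l have "j \<in> {1..i}" "\<kappa> \<in> int_partitions (i - j)"
        by (auto simp: int_partitions_def)
      with add show ?thesis by blast
    qed simp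
  qed
  moreover have "finite (insert {#} (\<Union>j\<in>{1..i}. add_mset j ` int_partitions (i - j)))"
    using less.IH by auto
  ultimately show ?case by (rule finite_subset)
qed


section \<open>Auxiliary umbrae\<close>

definition lower_factorial :: "'r::comm_ring_1 \<Rightarrow> nat \<Rightarrow> 'r" where
  "lower_factorial x m = (\<Prod>k<m. x - of_nat k)"

definition singleton_umbra ::
  "(('a, 'k::field_char_0) umbral_poly \<Rightarrow> 'k) \<Rightarrow> 'a \<Rightarrow> bool" where
  "singleton_umbra E \<chi> \<longleftrightarrow> E (umb \<chi>) = 1 \<and> (\<forall>j\<ge>2. E (umb \<chi> ^ j) = 0)"

text \<open>
  Auxiliary umbrae are elements of the alphabet determined only up to similarity, so they are
  rendered as predicates: \<open>dot_umbra E \<delta> \<gamma> \<alpha>\<close> says that \<open>\<delta>\<close> is a dot product \<open>\<gamma>.\<alpha>\<close>.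
\<close>

definition dot_umbra ::
  "(('a, 'k::field_char_0) umbral_poly \<Rightarrow> 'k) \<Rightarrow> 'a \<Rightarrow> 'a \<Rightarrow> 'a \<Rightarrow> bool" where
  "dot_umbra E \<delta> \<gamma> \<alpha> \<longleftrightarrow>
     (\<forall>i. E (umb \<delta> ^ i) =
        (\<Sum>\<mu>\<in>int_partitions i. E (lower_factorial (umb \<gamma>) (size \<mu>)) * d_coeff \<mu> *
           (\<Prod>j\<in>set_mset \<mu>. E (umb \<alpha> ^ j) ^ count \<mu> j)))"

definition uncorrelated_copies ::
  "(('a, 'k::field_char_0) umbral_poly \<Rightarrow> 'k) \<Rightarrow> nat \<Rightarrow> 'a \<Rightarrow> (nat \<Rightarrow> 'a) \<Rightarrow> bool" where
  "uncorrelated_copies E n \<alpha> \<alpha>s \<longleftrightarrow>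
     (\<forall>l\<in>{1..n}. similar E (umb (\<alpha>s l)) (umb \<alpha>)) \<and>
     (\<forall>l\<in>{1..n}. \<forall>m\<in>{1..n}. l \<noteq> m \<longrightarrow>
        uncorrelated (umb (\<alpha>s l) :: ('a, 'k) umbral_poly) (umb (\<alpha>s m)))"

text \<open>
  \<open>power_sum n \<alpha>s j\<close> is \<open>n.\<alpha>\<^sup>j\<close>; for \<open>j = 1\<close> it is \<open>n.\<alpha>\<close>.
\<close>

definition power_sum :: "nat \<Rightarrow> (nat \<Rightarrow> 'a) \<Rightarrow> nat \<Rightarrow> ('a, 'k::comm_ring_1) umbral_poly" where
  "power_sum n \<alpha>s j = (\<Sum>l=1..n. umb (\<alpha>s l) ^ j)"

text \<open>
  The moments \<open>(n)\<^sub>k\<close> of \<open>n.\<chi>\<close> vanish for \<open>k > n\<close>, so a multiplicative inverse can only be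
  required to invert the nonzero moments; the remaining ones are left unconstrained.
\<close>

definition inverse_umbra ::
  "(('a, 'k::field_char_0) umbral_poly \<Rightarrow> 'k) \<Rightarrow> 'a \<Rightarrow> ('a, 'k) umbral_poly \<Rightarrow> bool" where
  "inverse_umbra E \<beta> q \<longleftrightarrow> (\<forall>k. E (q ^ k) \<noteq> 0 \<longrightarrow> E (umb \<beta> ^ k) = 1 / E (q ^ k))"


section \<open>The polynomials \<open>p\<^sub>m\<close> and \<open>p\<^sub>\<mu>\<close>\<close>

definition p_poly :: "nat \<Rightarrow> 'k::field_char_0 poly" where
  "p_poly m = (\<Sum>k=1..m. monom (of_nat (Stirling m k) * (-1) ^ (k - 1) * fact (k - 1)) k)"

definition p_partition :: "nat multiset \<Rightarrow> 'k::field_char_0 poly" where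
  "p_partition \<mu> = (\<Prod>j\<in>set_mset \<mu>. p_poly j ^ count \<mu> j)"

definition subst_umbral ::
  "'k::field_char_0 poly \<Rightarrow> ('a, 'k) umbral_poly \<Rightarrow> ('a, 'k) umbral_poly" where
  "subst_umbral p q = poly (map_poly Const p) q"

end

theory Submission
  imports Defs "HOL-Computational_Algebra.Formal_Power_Series"
begin

text \<open>
  Let \<open>f(t) = 1 + a\<^sub>1 t + a\<^sub>2 t\<^sup>2 / 2! + \<cdots>\<close> be the exponential generating function of the moments of \<open>\<alpha>\<close>,
  and \<open>y\<close> the product of \<open>\<chi>.\<chi>\<close> with the inverse of \<open>n.\<chi>\<close>. Both sides of the claim turn out to be
  \<open>i!\<close> times the coefficient of \<open>t\<^sup>i\<close> in \<open>log f(t)\<close>.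

  The polynomial \<open>p\<^sub>m(y)\<close> is \<open>m!\<close> times the coefficient of \<open>z\<^sup>m\<close> in \<open>log (1 + y (e\<^sup>z - 1))\<close>
  (\<open>p_poly_binomial_sum\<close> states the differential equation of this logarithm). By the exponential
  formula, the sum over all partitions of \<open>i\<close> with coefficients \<open>d_coeff\<close> is \<open>i!\<close> times a coefficient
  of an exponential, here
  \<open>exp (\<Sum>\<^sub>m p\<^sub>m(y) (\<alpha>\<^sub>1\<^sup>m + \<cdots> + \<alpha>\<^sub>n\<^sup>m) t\<^sup>m / m!) = \<Prod>\<^sub>l (1 + y (exp (\<alpha>\<^sub>l t) - 1))\<close>
  (\<open>bell_p_poly_power_sum\<close>). As the \<open>\<alpha>\<^sub>l\<close> are uncorrelated with each other and with \<open>y\<close>, their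
  expectation gives \<open>(1 + y (f(t) - 1))\<^sup>n\<close>, that is the sum of the terms
  \<open>(n choose k) y\<^sup>k (f(t) - 1)\<^sup>k\<close> (\<open>E_mixture\<close>).

  Since \<open>y\<^sup>k\<close> has expectation \<open>(-1)\<^bsup>k-1\<^esup> (k - 1)! / (n)\<^sub>k\<close> for \<open>1 \<le> k \<le> n\<close> and
  \<open>(n choose k) / (n)\<^sub>k = 1 / k!\<close>, what remains is \<open>\<Sum>\<^sub>k (-1)\<^bsup>k-1\<^esup> (f(t) - 1)\<^sup>k / k\<close> over
  \<open>1 \<le> k \<le> n\<close>. This agrees with \<open>log f(t)\<close> up to \<open>t\<^sup>n\<close>, hence at \<open>t\<^sup>i\<close>; and the moments of
  \<open>\<chi>.\<alpha>\<close> are the coefficients of \<open>log f\<close> by grouping partitions by their number of parts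
  (\<open>weighted_partition_sum\<close>, \<open>dot_singleton_moment\<close>).
\<close>

section \<open>Removing a part from a partition\<close>

definition partition_symmetry :: "nat multiset \<Rightarrow> nat" where
  "partition_symmetry \<mu> = (\<Prod>j\<in>set_mset \<mu>. fact (count \<mu> j) * fact j ^ count \<mu> j)"

lemma d_coeff_eq: "d_coeff \<mu> = fact (\<Sum>\<^sub># \<mu>) / of_nat (partition_symmetry \<mu>)"
  by (simp add: d_coeff_def partition_symmetry_def prod.distrib)

lemma partition_symmetry_nonzero: "partition_symmetry \<mu> \<noteq> 0"
  by (simp add: partition_symmetry_def)

lemma partition_symmetry_superset:
  assumes "finite S" "set_mset \<mu> \<subseteq> S"
  shows "partition_symmetry \<mu> = (\<Prod>j\<in>S. fact (count \<mu> j) * fact j ^ count \<mu> j)"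
  unfolding partition_symmetry_def
  by (rule prod.mono_neutral_left) (use assms in \<open>auto simp: not_in_iff\<close>)

lemma partition_symmetry_add_mset:
  "partition_symmetry (add_mset j \<kappa>) = Suc (count \<kappa> j) * fact j * partition_symmetry \<kappa>"
proof -
  let ?S = "insert j (set_mset \<kappa>)"
  have "partition_symmetry (add_mset j \<kappa>) =
      (\<Prod>m\<in>?S. fact (count (add_mset j \<kappa>) m) * fact m ^ count (add_mset j \<kappa>) m)"
    by (rule partition_symmetry_superset) auto
  also have "\<dots> = fact (Suc (count \<kappa> j)) * fact j ^ Suc (count \<kappa> j) *
      (\<Prod>m\<in>?S - {j}. fact (count \<kappa> m) * fact m ^ count \<kappa> m)"
    by (subst prod.remove[of _ j]) (auto intro!: prod.cong)
  also have "\<dots> = Suc (count \<kappa> j) * fact j *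
      (\<Prod>m\<in>?S. fact (count \<kappa> m) * fact m ^ count \<kappa> m)"
    by (subst (2) prod.remove[of _ j]) (auto simp: algebra_simps)
  finally show ?thesis
    by (subst (asm) partition_symmetry_superset[of ?S \<kappa>, symmetric]) auto
qed

lemma sum_mset_eq_sum_count: "\<Sum>\<^sub># \<mu> = (\<Sum>j\<in>set_mset \<mu>. j * count \<mu> j)" for \<mu> :: "nat multiset"
proof -
  have *: "\<Sum>\<^sub># \<mu> = (\<Sum>j\<in>S. j * count \<mu> j)" if "finite S" "set_mset \<mu> \<subseteq> S" for S
    using that
  proof (induction \<mu>)
    case (add x \<mu>)
    have "(\<Sum>j\<in>S. j * count (add_mset x \<mu>) j) = (\<Sum>j\<in>S. j * count \<mu> j + (if j = x then j else 0))"
      by (intro sum.cong) (auto simp: algebra_simps)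
    also have "\<dots> = \<Sum>\<^sub># \<mu> + x"
      using add by (simp add: sum.distrib)
    finally show ?case by simp
  qed simp
  show ?thesis by (rule *) auto
qed

text \<open>
  Deleting a part \<open>j + 1\<close> divides the denominator \<open>partition_symmetry\<close> by \<open>count \<cdot> (j + 1)!\<close>;
  the \<open>j!\<close> in the binomial coefficient cancels all of this but \<open>(j + 1) \<cdot> count\<close>, which is what all
  copies of that part together contribute to the sum of the parts.
\<close>

lemma d_coeff_remove_part:
  assumes "\<kappa> \<in> int_partitions (i - j)" "j \<le> i"
  shows "(of_nat (i choose j) * d_coeff \<kappa> :: 'k::field_char_0) =
    fact i * of_nat (Suc j * count (add_mset (Suc j) \<kappa>) (Suc j)) /
      of_nat (partition_symmetry (add_mset (Suc j) \<kappa>))"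
proof -
  let ?c = "count \<kappa> (Suc j)"
  have total: "\<Sum>\<^sub># \<kappa> = i - j" using assms by (simp add: int_partitions_def)
  have "of_nat (partition_symmetry (add_mset (Suc j) \<kappa>)) =
      (of_nat (Suc j * Suc ?c) * (fact j * of_nat (partition_symmetry \<kappa>)) :: 'k)"
    by (simp add: partition_symmetry_add_mset algebra_simps)
  moreover have "(of_nat (i choose j) :: 'k) = fact i / (fact j * fact (i - j))"
    using assms by (simp add: binomial_fact)
  moreover have "of_nat (Suc j * Suc ?c) \<noteq> (0::'k)"
    unfolding of_nat_eq_0_iff by simp
  ultimately show ?thesis
    by (simp add: d_coeff_eq total partition_symmetry_nonzero del: of_nat_Suc of_nat_mult mult_Suc mult_Suc_right)
qed

text \<open>
  In terms of set partitions of \<open>i + 1\<close> points, which \<open>d_coeff\<close> counts by block sizes: remove the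
  block of the last point, whose other \<open>j - 1\<close> points are chosen among \<open>i\<close>. Algebraically, the
  summands are proportional to \<open>j \<cdot> count \<mu> j\<close>, and these numbers add up to \<open>i + 1\<close>.
\<close>

lemma d_coeff_recursion:
  assumes "\<mu> \<in> int_partitions (Suc i)"
  shows "(d_coeff \<mu> :: 'k::field_char_0) =
    (\<Sum>j\<in>set_mset \<mu>. of_nat (i choose (j - 1)) * d_coeff (\<mu> - {#j#}))"
proof -
  have total: "\<Sum>\<^sub># \<mu> = Suc i" and nonzero: "0 \<notin># \<mu>"
    using assms by (auto simp: int_partitions_def)
  have part: "of_nat (i choose (j - 1)) * d_coeff (\<mu> - {#j#}) =
      (fact i * of_nat (j * count \<mu> j) / of_nat (partition_symmetry \<mu>) :: 'k)"
    if "j \<in># \<mu>" for j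
  proof -
    obtain \<kappa> where \<mu>: "\<mu> = add_mset j \<kappa>" using insert_DiffM[OF \<open>j \<in># \<mu>\<close>] by metis
    obtain m where j: "j = Suc m" using \<open>j \<in># \<mu>\<close> nonzero by (cases j) auto
    show ?thesis
      using d_coeff_remove_part[of \<kappa> i m] total nonzero
      by (auto simp: \<mu> j int_partitions_def)
  qed
  have "(\<Sum>j\<in>set_mset \<mu>. of_nat (i choose (j - 1)) * d_coeff (\<mu> - {#j#})) =
      (fact i * of_nat (\<Sum>j\<in>set_mset \<mu>. j * count \<mu> j) / of_nat (partition_symmetry \<mu>) :: 'k)"
    by (simp only: of_nat_sum sum_distrib_left sum_divide_distrib) (intro sum.cong refl part)
  also have "\<dots> = d_coeff \<mu>"
    by (simp add: d_coeff_eq total flip: sum_mset_eq_sum_count)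
  finally show ?thesis by simp
qed

lemma int_partitions_0: "int_partitions 0 = {{#}}"
proof -
  have "\<mu> = {#}" if "0 \<notin># \<mu>" "\<Sum>\<^sub># \<mu> = 0" for \<mu> :: "nat multiset"
    using that by (cases \<mu>) auto
  thus ?thesis by (auto simp: int_partitions_def)
qed

section \<open>Exponential generating functions over a ring with scalars\<close>

text \<open>
  The partition sums have to be manipulated both in the field and in the ring of umbral polynomials.
  The latter is not a field, so all that is used of the ring is that it receives the field by a ring
  homomorphism \<open>h\<close>, which supplies the factors \<open>1 / i!\<close>.
\<close>

locale scalar_hom =
  fixes h :: "'k::field_char_0 \<Rightarrow> 'r::comm_ring_1"
  assumes h_add: "h (a + b) = h a + h b"
    and h_mult: "h (a * b) = h a * h b"
    and h_one: "h 1 = 1"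
begin

lemma h_zero: "h 0 = 0"
  using h_add[of 0 0] by simp

lemma h_of_nat: "h (of_nat m) = of_nat m"
  by (induction m) (simp_all add: h_zero h_add h_one)

lemma h_sum: "h (\<Sum>x\<in>S. f x) = (\<Sum>x\<in>S. h (f x))"
  by (induction S rule: infinite_finite_induct) (simp_all add: h_zero h_add)

lemma h_cancel:
  assumes "c \<noteq> 0" "h c * x = h c * y"
  shows "x = y"
proof -
  have "h (1 / c) * (h c * x) = h (1 / c) * (h c * y)" using assms(2) by simp
  thus ?thesis using assms(1) by (simp flip: mult.assoc h_mult add: h_one)
qed

text \<open>
  The weight \<open>W\<close> is arbitrary because two kinds of weight occur: products over the parts, and such
  products times a function of the number of parts.
\<close>

lemma partition_sum_recursion:
  "(\<Sum>\<mu>\<in>int_partitions (Suc i). h (d_coeff \<mu>) * W \<mu>) =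
   (\<Sum>j\<le>i. of_nat (i choose j) *
     (\<Sum>\<kappa>\<in>int_partitions (i - j). h (d_coeff \<kappa>) * W (add_mset (Suc j) \<kappa>)))"
proof -
  \<comment> \<open>A partition with a marked part \<open>j\<close> is the same as \<open>j\<close> and the partition of the rest.\<close>
  let ?A = "Sigma (int_partitions (Suc i)) set_mset"
  let ?B = "Sigma {..i} (\<lambda>j. int_partitions (i - j))"
  have "(\<Sum>\<mu>\<in>int_partitions (Suc i). h (d_coeff \<mu>) * W \<mu>) =
      (\<Sum>\<mu>\<in>int_partitions (Suc i). \<Sum>j\<in>set_mset \<mu>.
        of_nat (i choose (j - 1)) * (h (d_coeff (\<mu> - {#j#})) * W \<mu>))"
    by (intro sum.cong refl)
      (subst d_coeff_recursion,
        auto simp: h_sum h_mult h_of_nat sum_distrib_left sum_distrib_right mult.assoc)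
  also have "\<dots> = (\<Sum>(\<mu>, j)\<in>?A. of_nat (i choose (j - 1)) * (h (d_coeff (\<mu> - {#j#})) * W \<mu>))"
    by (rule sum.Sigma) (auto simp: finite_int_partitions)
  also have "\<dots> = (\<Sum>(j, \<kappa>)\<in>?B. of_nat (i choose j) * (h (d_coeff \<kappa>) * W (add_mset (Suc j) \<kappa>)))"
  proof (rule sum.reindex_bij_witness[of _
        "\<lambda>(j, \<kappa>). (add_mset (Suc j) \<kappa>, Suc j)" "\<lambda>(\<mu>, j). (j - 1, \<mu> - {#j#})"])
    fix x assume "x \<in> ?A"
    then obtain \<mu> j where x: "x = (\<mu>, j)" "\<mu> \<in> int_partitions (Suc i)" "j \<in># \<mu>" by auto
    then obtain \<kappa> where \<mu>: "\<mu> = add_mset j \<kappa>" using multi_member_split by metis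
    with x obtain m where j: "j = Suc m" by (cases j) (auto simp: int_partitions_def)
    show "(case case x of (\<mu>, j) \<Rightarrow> (j - 1, \<mu> - {#j#}) of
        (j, \<kappa>) \<Rightarrow> (add_mset (Suc j) \<kappa>, Suc j)) = x"
      and "(case x of (\<mu>, j) \<Rightarrow> (j - 1, \<mu> - {#j#})) \<in> ?B"
      and "(case case x of (\<mu>, j) \<Rightarrow> (j - 1, \<mu> - {#j#}) of
          (j, \<kappa>) \<Rightarrow> of_nat (i choose j) * (h (d_coeff \<kappa>) * W (add_mset (Suc j) \<kappa>))) =
        (case x of (\<mu>, j) \<Rightarrow> of_nat (i choose (j - 1)) * (h (d_coeff (\<mu> - {#j#})) * W \<mu>))"
      using x by (auto simp: \<mu> j int_partitions_def)
  qed (auto simp: int_partitions_def)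
  also have "\<dots> = (\<Sum>j\<le>i. \<Sum>\<kappa>\<in>int_partitions (i - j).
      of_nat (i choose j) * (h (d_coeff \<kappa>) * W (add_mset (Suc j) \<kappa>)))"
    by (rule sum.Sigma[symmetric]) (auto simp: finite_int_partitions)
  finally show ?thesis by (simp add: sum_distrib_left)
qed

definition egf :: "(nat \<Rightarrow> 'r) \<Rightarrow> 'r fps" where
  "egf x = Abs_fps (\<lambda>i. h (1 / fact i) * x i)"

lemma egf_nth: "fps_nth (egf x) i = h (1 / fact i) * x i"
  by (simp add: egf_def)

lemma egf_eq_iff: "egf x = egf y \<longleftrightarrow> (\<forall>i. x i = y i)"
  using h_cancel[of "1 / fact _"] by (auto simp: fps_eq_iff egf_nth)

lemma egf_deriv: "fps_deriv (egf x) = egf (\<lambda>i. x (Suc i))"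
proof (rule fps_ext)
  fix i
  have "of_nat (Suc i) * h (1 / fact (Suc i)) = h (of_nat (Suc i) * (1 / fact (Suc i)))"
    by (simp only: h_mult h_of_nat)
  also have "of_nat (Suc i) * (1 / fact (Suc i)) = (1 / fact i :: 'k)"
    by (simp add: divide_simps del: of_nat_Suc)
  finally show "fps_nth (fps_deriv (egf x)) i = fps_nth (egf (\<lambda>i. x (Suc i))) i"
    by (simp add: egf_nth del: of_nat_Suc flip: mult.assoc)
qed

lemma egf_mult: "egf x * egf y = egf (\<lambda>i. \<Sum>j\<le>i. of_nat (i choose j) * x j * y (i - j))"
proof (rule fps_ext)
  fix i
  have "fps_nth (egf x * egf y) i = (\<Sum>j\<le>i. h (1 / fact j * (1 / fact (i - j))) * (x j * y (i - j)))"
    unfolding h_mult by (simp add: fps_mult_nth egf_nth atLeast0AtMost mult_ac)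
  also have "\<dots> = (\<Sum>j\<le>i. h (1 / fact i * of_nat (i choose j)) * (x j * y (i - j)))"
  proof (intro sum.cong refl)
    fix j assume "j \<in> {..i}"
    hence "1 / fact j * (1 / fact (i - j)) = (1 / fact i * of_nat (i choose j) :: 'k)"
      by (simp add: binomial_fact)
    thus "h (1 / fact j * (1 / fact (i - j))) * (x j * y (i - j)) =
        h (1 / fact i * of_nat (i choose j)) * (x j * y (i - j))"
      by (rule arg_cong)
  qed
  also have "\<dots> = (\<Sum>j\<le>i. h (1 / fact i) * (of_nat (i choose j) * x j * y (i - j)))"
    unfolding h_mult h_of_nat by (simp add: mult.assoc)
  finally show "fps_nth (egf x * egf y) i =
      fps_nth (egf (\<lambda>i. \<Sum>j\<le>i. of_nat (i choose j) * x j * y (i - j))) i"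
    by (simp add: egf_nth sum_distrib_left)
qed

text \<open>
  Comparing coefficients determines \<open>(m + 1) A\<^bsub>m+1\<^esub>\<close> from \<open>A\<^sub>0, \<dots>, A\<^sub>m\<close>, and \<open>m + 1\<close> is invertible
  since it is the image of a nonzero scalar.
\<close>

lemma fps_linear_ode_unique:
  fixes A B C :: "'r fps"
  assumes "fps_deriv A = C * A" "fps_deriv B = C * B" "fps_nth A 0 = fps_nth B 0"
  shows "A = B"
proof (rule fps_ext)
  fix i show "fps_nth A i = fps_nth B i"
  proof (induction i rule: less_induct)
    case (less i)
    show ?case
    proof (cases i)
      case (Suc m)
      have "fps_nth (C * A) m = fps_nth (C * B) m"
        unfolding fps_mult_nth by (intro sum.cong refl arg_cong2[of _ _ _ _ "(*)"] less) (simp add: Suc)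
      hence "fps_nth (fps_deriv A) m = fps_nth (fps_deriv B) m"
        using assms by simp
      hence "h (of_nat (Suc m)) * fps_nth A (Suc m) = h (of_nat (Suc m)) * fps_nth B (Suc m)"
        by (simp add: h_of_nat del: of_nat_Suc)
      moreover have "of_nat (Suc m) \<noteq> (0::'k)"
        by (simp only: of_nat_eq_0_iff)
      ultimately show ?thesis
        unfolding Suc using h_cancel by blast
    qed (simp add: assms)
  qed
qed

text \<open>
  The complete exponential Bell polynomials: \<open>egf (bell x)\<close> is \<open>exp X\<close> where \<open>X\<close> is the generating
  function of \<open>x\<^sub>1, x\<^sub>2, \<dots>\<close> without constant term. The exponential enters only through its differential
  equation \<open>F' = X' F\<close>.
\<close>

definition bell :: "(nat \<Rightarrow> 'r) \<Rightarrow> nat \<Rightarrow> 'r" where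
  "bell x i = (\<Sum>\<mu>\<in>int_partitions i. h (d_coeff \<mu>) * (\<Prod>j\<in>#\<mu>. x j))"

lemma bell_0: "bell x 0 = 1"
  by (simp add: bell_def int_partitions_0 d_coeff_def h_one)

lemma bell_Suc:
  "bell x (Suc i) = (\<Sum>j\<le>i. of_nat (i choose j) * x (Suc j) * bell x (i - j))"
  by (simp add: bell_def partition_sum_recursion sum_distrib_left mult_ac)

lemma egf_bell_deriv: "fps_deriv (egf (bell x)) = egf (\<lambda>i. x (Suc i)) * egf (bell x)"
  by (simp add: egf_deriv egf_mult bell_Suc)

lemma bell_unique:
  assumes "y 0 = 1" "\<And>i. y (Suc i) = (\<Sum>j\<le>i. of_nat (i choose j) * x (Suc j) * y (i - j))"
  shows "bell x i = y i"
proof -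
  have "egf (bell x) = egf y"
    by (rule fps_linear_ode_unique[OF egf_bell_deriv])
      (simp_all add: egf_deriv egf_mult egf_nth bell_0 assms)
  thus ?thesis by (simp add: egf_eq_iff)
qed

text \<open>
  This is \<open>exp (X + Y) = exp X \<cdot> exp Y\<close>: both sides solve \<open>F' = (X' + Y') F\<close>.
\<close>

lemma egf_bell_add: "egf (bell (\<lambda>j. x j + y j)) = egf (bell x) * egf (bell y)"
proof (rule fps_linear_ode_unique[OF egf_bell_deriv])
  have "egf (\<lambda>i. x (Suc i) + y (Suc i)) = egf (\<lambda>i. x (Suc i)) + egf (\<lambda>i. y (Suc i))"
    by (simp add: fps_eq_iff egf_nth distrib_left)
  thus "fps_deriv (egf (bell x) * egf (bell y)) =
      egf (\<lambda>i. x (Suc i) + y (Suc i)) * (egf (bell x) * egf (bell y))"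
    by (simp add: egf_bell_deriv algebra_simps)
qed (simp add: egf_nth bell_0 h_one)

lemma bell_add:
  "bell (\<lambda>j. x j + y j) i = (\<Sum>j\<le>i. of_nat (i choose j) * bell x j * bell y (i - j))"
  using egf_bell_add[of x y] by (simp add: egf_mult egf_eq_iff)

end

section \<open>The polynomials \<open>p\<^sub>m\<close> as logarithmic coefficients\<close>

lemma coeff_p_poly:
  "coeff (p_poly m) k =
    (if k = 0 then 0 else of_nat (Stirling m k) * (-1) ^ (k - 1) * fact (k - 1))"
proof -
  have "coeff (p_poly m :: 'a poly) k =
      (\<Sum>l=1..m. if l = k then of_nat (Stirling m l) * (-1) ^ (l - 1) * fact (l - 1) else 0)"
    unfolding p_poly_def coeff_sum coeff_monom ..
  thus ?thesis by auto
qed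

text \<open>
  For \<open>P = log (1 + y (e\<^sup>z - 1))\<close>, the generating function of the \<open>p\<^sub>m(y)\<close>, the derivatives by \<open>z\<close>
  and by \<open>y\<close> satisfy \<open>\<partial>\<^sub>z P = y + (y - y\<^sup>2) \<partial>\<^sub>y P\<close>. On coefficients it is the recurrence of the Stirling
  numbers of the second kind.
\<close>

lemma p_poly_Suc_Suc:
  "p_poly (Suc (Suc m)) = ([:0, 1:] - [:0, 1:]\<^sup>2) * pderiv (p_poly (Suc m))"
proof (rule poly_eqI)
  fix k
  have factor: "([:0, 1:] - [:0, 1:]\<^sup>2) * q = pCons 0 (q - pCons 0 q)" for q :: "'a poly"
    by (simp add: power2_eq_square algebra_simps)
  show "coeff (p_poly (Suc (Suc m)) :: 'a poly) k =
      coeff (([:0, 1:] - [:0, 1:]\<^sup>2) * pderiv (p_poly (Suc m))) k"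
    unfolding factor
    by (cases k)
      (auto simp: coeff_p_poly coeff_pCons coeff_pderiv algebra_simps split: nat.splits)
qed

lemma p_poly_1: "p_poly (Suc 0) = [:0, 1:]"
  by (simp add: p_poly_def monom_Suc monom_0)

text \<open>
  With \<open>P\<close> as before, these are the coefficients of \<open>(1 - y + y e\<^sup>z) \<partial>\<^sub>z P = y e\<^sup>z\<close>, the equation
  that characterizes \<open>P\<close> as the logarithm of \<open>1 + y (e\<^sup>z - 1)\<close>.
\<close>

lemma p_poly_binomial_sum:
  fixes s :: "nat \<Rightarrow> 'k::field_char_0 poly"
  defines "s \<equiv> \<lambda>i. \<Sum>j\<le>i. of_nat (i choose j) * p_poly (Suc j)"
  shows "(1 - [:0, 1:]) * p_poly (Suc i) + [:0, 1:] * s i = [:0, 1:]"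
proof -
  \<comment> \<open>The derivation \<open>D\<close> maps \<open>p\<^sub>j\<close> to \<open>p\<^bsub>j+1\<^esub>\<close>, so it advances the claim from \<open>i\<close> to \<open>i + 1\<close>.\<close>
  define D where "D q = ([:0, 1:] - [:0, 1:]\<^sup>2) * pderiv q" for q :: "'k poly"
  have D_sum: "D (sum f A) = (\<Sum>j\<in>A. D (f j))" for f :: "nat \<Rightarrow> 'k poly" and A
    by (induction A rule: infinite_finite_induct)
      (auto simp: D_def pderiv_add algebra_simps)
  have D_mult: "D (q * r) = D q * r + q * D r" for q r
    by (simp add: D_def pderiv_mult algebra_simps)
  have D_add: "D (q + r) = D q + D r" for q r
    by (simp add: D_def pderiv_add algebra_simps)
  have D_p: "D (p_poly (Suc j)) = p_poly (Suc (Suc j))" for j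
    by (simp add: D_def p_poly_Suc_Suc)
  \<comment> \<open>Pascal's rule splits \<open>s\<^bsub>i+1\<^esub>\<close> into \<open>s\<^sub>i\<close> and the sum with indices shifted by one, which is \<open>D s\<^sub>i\<close>.\<close>
  have s_Suc: "s (Suc i) = s i + D (s i)" for i
  proof -
    have "s (Suc i) = p_poly (Suc 0) +
        (\<Sum>j\<le>i. of_nat (i choose Suc j) * p_poly (Suc (Suc j))) +
        (\<Sum>j\<le>i. of_nat (i choose j) * p_poly (Suc (Suc j)))"
      unfolding s_def by (subst sum.atMost_Suc_shift) (simp add: algebra_simps sum.distrib)
    also have "p_poly (Suc 0) + (\<Sum>j\<le>i. of_nat (i choose Suc j) * p_poly (Suc (Suc j))) =
        (\<Sum>j\<le>Suc i. of_nat (i choose j) * p_poly (Suc j) :: 'k poly)"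
      by (subst sum.atMost_Suc_shift) simp
    also have "\<dots> = s i" by (simp add: s_def)
    also have "(\<Sum>j\<le>i. of_nat (i choose j) * p_poly (Suc (Suc j))) = D (s i)"
      unfolding s_def D_sum D_mult D_p by (simp add: D_def)
    finally show ?thesis .
  qed
  show ?thesis
  proof (induction i)
    case 0
    show ?case by (simp add: s_def p_poly_1 algebra_simps)
  next
    case (Suc i)
    let ?y = "[:0, 1:] :: 'k poly"
    have Dy: "D ?y = ?y - ?y\<^sup>2" "D (1 - ?y) = - (?y - ?y\<^sup>2)"
      by (simp_all add: D_def pderiv_pCons pderiv_diff)
    \<comment> \<open>Writing \<open>r\<^sub>i\<close> for the left-hand side, \<open>r\<^bsub>i+1\<^esub> = D r\<^sub>i + y r\<^sub>i\<close>, and \<open>D y + y\<^sup>2 = y\<close>.\<close>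
    have "(1 - ?y) * p_poly (Suc (Suc i)) + ?y * s (Suc i) =
        D ((1 - ?y) * p_poly (Suc i) + ?y * s i) +
        ?y * ((1 - ?y) * p_poly (Suc i) + ?y * s i)"
      unfolding D_add D_mult D_p Dy s_Suc by (simp add: algebra_simps power2_eq_square)
    also have "\<dots> = ?y"
      unfolding Suc Dy by (simp add: power2_eq_square)
    finally show ?case .
  qed
qed

text \<open>
  The form in which the Bell recurrence uses the previous identity: the last factor is
  entry \<open>i - j\<close> of the sequence \<open>1, y, y, \<dots>\<close> with generating function \<open>1 + y (e\<^sup>z - 1)\<close>.
\<close>

lemma p_poly_convolution:
  "(\<Sum>j\<le>i. of_nat (i choose j) * p_poly (Suc j) * (if j = i then 1 else [:0, 1:])) =
    ([:0, 1:] :: 'k::field_char_0 poly)"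
proof -
  let ?y = "[:0, 1:] :: 'k poly"
  have "(\<Sum>j\<le>i. of_nat (i choose j) * p_poly (Suc j) * (if j = i then 1 else ?y)) =
      (\<Sum>j\<le>i. ?y * (of_nat (i choose j) * p_poly (Suc j)) +
        (if j = i then (1 - ?y) * p_poly (Suc i) else 0))"
    by (intro sum.cong) (auto simp: algebra_simps)
  also have "\<dots> = (1 - ?y) * p_poly (Suc i) +
      ?y * (\<Sum>j\<le>i. of_nat (i choose j) * p_poly (Suc j))"
    by (simp only: sum.distrib sum_distrib_left) (simp add: add.commute)
  also have "\<dots> = ?y" by (rule p_poly_binomial_sum)
  finally show ?thesis .
qed

section \<open>The partition sum of umbral polynomials\<close>

lemma scalar_hom_Const: "scalar_hom (Const :: 'k::field_char_0 \<Rightarrow> ('a, 'k) umbral_poly)"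
  by unfold_locales (simp_all add: Const_def single_add mult_single)

lemma scalar_hom_ident: "scalar_hom (\<lambda>c::'k::field_char_0. c)"
  by unfold_locales simp_all

interpretation umbral_scalars: scalar_hom "Const :: 'k::field_char_0 \<Rightarrow> ('a, 'k) umbral_poly"
  by (rule scalar_hom_Const)

interpretation field_scalars: scalar_hom "\<lambda>c::'k::field_char_0. c"
  by (rule scalar_hom_ident)

lemma subst_umbral_0: "subst_umbral 0 z = 0"
  by (simp add: subst_umbral_def)

lemma subst_umbral_pCons: "subst_umbral (pCons a p) z = Const a + z * subst_umbral p z"
  by (simp add: subst_umbral_def map_poly_pCons umbral_scalars.h_zero)

lemma subst_umbral_var: "subst_umbral [:0, 1:] z = z"
  by (simp add: subst_umbral_pCons subst_umbral_0 umbral_scalars.h_zero umbral_scalars.h_one)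

lemma subst_umbral_1: "subst_umbral 1 z = 1"
  by (simp add: one_pCons subst_umbral_pCons subst_umbral_0 umbral_scalars.h_one)

lemma subst_umbral_add: "subst_umbral (p + q) z = subst_umbral p z + subst_umbral q z"
  by (induction p q rule: poly_induct2)
    (simp_all add: subst_umbral_pCons subst_umbral_0 umbral_scalars.h_add algebra_simps)

lemma subst_umbral_mult: "subst_umbral (p * q) z = subst_umbral p z * subst_umbral q z"
proof -
  have smult: "subst_umbral (smult c q) z = Const c * subst_umbral q z" for c q
    by (induction q)
      (simp_all add: subst_umbral_pCons subst_umbral_0 umbral_scalars.h_mult algebra_simps)
  show ?thesis
    by (induction p)
      (simp_all add: subst_umbral_pCons subst_umbral_0 subst_umbral_add smult
        umbral_scalars.h_zero algebra_simps)
qed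

lemma subst_umbral_sum: "subst_umbral (sum f A) z = (\<Sum>x\<in>A. subst_umbral (f x) z)"
  by (induction A rule: infinite_finite_induct) (simp_all add: subst_umbral_0 subst_umbral_add)

lemma subst_umbral_prod: "subst_umbral (prod f A) z = (\<Prod>x\<in>A. subst_umbral (f x) z)"
  by (induction A rule: infinite_finite_induct) (simp_all add: subst_umbral_1 subst_umbral_mult)

lemma subst_umbral_power: "subst_umbral (p ^ m) z = subst_umbral p z ^ m"
  by (induction m) (simp_all add: subst_umbral_1 subst_umbral_mult)

lemma subst_umbral_of_nat: "subst_umbral (of_nat m) z = of_nat m"
  by (induction m) (simp_all add: subst_umbral_0 subst_umbral_1 subst_umbral_add)

text \<open>
  Exponentiating the logarithm: for a single \<open>x\<close> the generating function is \<open>1 + y (e\<^bsup>xt\<^esup> - 1)\<close>.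
\<close>

lemma bell_p_poly:
  "umbral_scalars.bell (\<lambda>j. subst_umbral (p_poly j) y * x ^ j) i =
    (if i = 0 then 1 else y * x ^ i)"
proof (rule umbral_scalars.bell_unique)
  fix i :: nat
  let ?one_or = "\<lambda>j. if j = i then 1 else y"
  have "y * x ^ Suc i = subst_umbral [:0, 1:] y * x ^ Suc i"
    by (simp only: subst_umbral_var)
  also have "\<dots> = (\<Sum>j\<le>i. of_nat (i choose j) * subst_umbral (p_poly (Suc j)) y * ?one_or j) *
      x ^ Suc i"
    by (subst p_poly_convolution[of i, symmetric])
      (simp add: subst_umbral_sum subst_umbral_mult subst_umbral_of_nat subst_umbral_1
        subst_umbral_var if_distrib[of "\<lambda>p. subst_umbral p y"] cong: if_cong)
  also have "\<dots> = (\<Sum>j\<le>i. of_nat (i choose j) * (subst_umbral (p_poly (Suc j)) y * x ^ Suc j) *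
      (if i - j = 0 then 1 else y * x ^ (i - j)))"
    unfolding sum_distrib_right
  proof (intro sum.cong refl)
    fix j assume j: "j \<in> {..i}"
    hence "x ^ Suc i = x ^ Suc j * x ^ (i - j)"
      by (simp flip: power_add del: power_Suc)
    thus "of_nat (i choose j) * subst_umbral (p_poly (Suc j)) y * ?one_or j * x ^ Suc i =
        of_nat (i choose j) * (subst_umbral (p_poly (Suc j)) y * x ^ Suc j) *
        (if i - j = 0 then 1 else y * x ^ (i - j))"
      using j by (cases "j = i") (simp_all add: mult_ac)
  qed
  finally show "(if Suc i = 0 then 1 else y * x ^ Suc i) =
      (\<Sum>j\<le>i. of_nat (i choose j) * (subst_umbral (p_poly (Suc j)) y * x ^ Suc j) *
        (if i - j = 0 then 1 else y * x ^ (i - j)))"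
    by simp
qed simp

text \<open>
  Up to \<open>i!\<close> the coefficient of \<open>t\<^sup>i\<close> in \<open>\<Prod>\<^sub>l (1 + y (exp (x\<^sub>l t) - 1))\<close>, \<open>l = 1, \<dots>, n\<close>. The recursion
  splits off the last factor, the only one containing \<open>x\<^sub>n\<close>.
\<close>

fun mixture :: "'r::comm_ring_1 \<Rightarrow> (nat \<Rightarrow> 'r) \<Rightarrow> nat \<Rightarrow> nat \<Rightarrow> 'r" where
  "mixture y x 0 i = of_bool (i = 0)"
| "mixture y x (Suc n) i =
    (\<Sum>j\<le>i. of_nat (i choose j) * mixture y x n j * (if j = i then 1 else y * x (Suc n) ^ (i - j)))"

text \<open>
  A power sum is additive in its \<open>n\<close> umbrae, so the exponential turns it into a product over them.
\<close>

lemma bell_p_poly_power_sum: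
  "umbral_scalars.bell (\<lambda>j. subst_umbral (p_poly j) y * power_sum n \<alpha>s j) i =
    mixture y (\<lambda>l. umb (\<alpha>s l)) n i"
proof (induction n arbitrary: i)
  case 0
  show ?case
    by (rule umbral_scalars.bell_unique) (simp_all add: power_sum_def)
next
  case (Suc n)
  have "(\<lambda>j. subst_umbral (p_poly j) y * power_sum (Suc n) \<alpha>s j) =
      (\<lambda>j. subst_umbral (p_poly j) y * power_sum n \<alpha>s j +
        subst_umbral (p_poly j) y * umb (\<alpha>s (Suc n)) ^ j)"
    by (simp add: power_sum_def algebra_simps)
  thus ?case
    by (auto simp: umbral_scalars.bell_add Suc bell_p_poly intro!: sum.cong)
qed

lemma umbral_sum_eq_bell:
  "(\<Sum>\<mu>\<in>int_partitions i. Const (d_coeff \<mu>) * subst_umbral (p_partition \<mu>) y *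
      (\<Prod>j\<in>set_mset \<mu>. power_sum n \<alpha>s j ^ count \<mu> j)) =
    umbral_scalars.bell (\<lambda>j. subst_umbral (p_poly j) y * power_sum n \<alpha>s j) i"
  by (simp add: umbral_scalars.bell_def p_partition_def subst_umbral_prod subst_umbral_power
      image_prod_mset_multiplicity power_mult_distrib prod.distrib mult.assoc)

section \<open>Cumulants and powers of the reduced generating function\<close>

text \<open>
  With \<open>f\<close> the exponential generating function of \<open>1, a\<^sub>1, a\<^sub>2, \<dots>\<close>, this is \<open>i!\<close> times the coefficient of
  \<open>t\<^sup>i\<close> in \<open>(f - 1)\<^sup>k\<close>. The recursion multiplies by one more factor \<open>f - 1\<close>; in an
  expectation this factor is contributed by one more umbra.
\<close>

primrec reduced_power :: "(nat \<Rightarrow> 'k::field_char_0) \<Rightarrow> nat \<Rightarrow> nat \<Rightarrow> 'k" where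
  "reduced_power a 0 i = of_bool (i = 0)"
| "reduced_power a (Suc k) i = (\<Sum>j<i. of_nat (i choose j) * reduced_power a k j * a (i - j))"

lemma reduced_power_eq_0: "i < k \<Longrightarrow> reduced_power a k i = 0"
  by (induction k arbitrary: i) auto

lemma egf_reduced_power:
  "field_scalars.egf (reduced_power a k) = field_scalars.egf (\<lambda>i. if i = 0 then 0 else a i) ^ k"
proof (induction k)
  case 0
  show ?case by (auto simp: fps_eq_iff field_scalars.egf_nth)
next
  case (Suc k)
  have "reduced_power a (Suc k) i =
      (\<Sum>j\<le>i. of_nat (i choose j) * reduced_power a k j * (if i - j = 0 then 0 else a (i - j)))" for i
    by (simp add: lessThan_Suc_atMost[symmetric])
  thus ?case
    unfolding power_Suc2 Suc[symmetric] field_scalars.egf_mult by presburger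
qed

text \<open>
  The derivative of \<open>(f - 1)\<^bsup>k+1\<^esup>\<close> is \<open>(k + 1) f' (f - 1)\<^sup>k\<close>.
\<close>

lemma reduced_power_Suc_Suc:
  "reduced_power a (Suc k) (Suc i) =
    of_nat (Suc k) * (\<Sum>j\<le>i. of_nat (i choose j) * a (Suc j) * reduced_power a k (i - j))"
proof -
  let ?g = "field_scalars.egf (\<lambda>i. if i = 0 then 0 else a i)"
  have "field_scalars.egf (\<lambda>i. reduced_power a (Suc k) (Suc i)) = fps_deriv (?g ^ Suc k)"
    by (simp only: egf_reduced_power flip: field_scalars.egf_deriv)
  also have "\<dots> = fps_const (of_nat (Suc k)) *
      (field_scalars.egf (\<lambda>i. a (Suc i)) * field_scalars.egf (reduced_power a k))"
    unfolding fps_deriv_power field_scalars.egf_deriv egf_reduced_power by (simp add: mult.assoc)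
  also have "\<dots> = field_scalars.egf (\<lambda>i. of_nat (Suc k) *
      (\<Sum>j\<le>i. of_nat (i choose j) * a (Suc j) * reduced_power a k (i - j)))"
    unfolding field_scalars.egf_mult by (simp add: fps_eq_iff field_scalars.egf_nth)
  finally show ?thesis unfolding field_scalars.egf_eq_iff by blast
qed

text \<open>
  The partitions with exactly \<open>k\<close> parts contribute the partial Bell polynomial
  \<open>i! [t\<^sup>i] (f - 1)\<^sup>k / k!\<close>. A general weight \<open>\<phi>\<close> keeps track of \<open>k\<close>, since removing a part replaces
  \<open>\<phi>\<close> by its shift. The bound \<open>N\<close> is free because the terms with \<open>k > i\<close> vanish.
\<close>

lemma weighted_partition_sum:
  assumes "i \<le> N"
  shows "(\<Sum>\<mu>\<in>int_partitions i. d_coeff \<mu> * (\<phi> (size \<mu>) * (\<Prod>j\<in>#\<mu>. a j))) =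
    (\<Sum>k\<le>N. \<phi> k * reduced_power a k i / fact k)"
  using assms
proof (induction i arbitrary: \<phi> rule: less_induct)
  case (less i)
  show ?case
  proof (cases i)
    case 0
    have "(\<Sum>k\<le>N. \<phi> k * reduced_power a k 0 / fact k) = (\<Sum>k\<in>{0}. \<phi> k * reduced_power a k 0 / fact k)"
      by (rule sum.mono_neutral_right) (auto simp: reduced_power_eq_0)
    thus ?thesis by (simp add: 0 int_partitions_0 d_coeff_def)
  next
    case (Suc m)
    have "(\<Sum>\<mu>\<in>int_partitions i. d_coeff \<mu> * (\<phi> (size \<mu>) * (\<Prod>j\<in>#\<mu>. a j))) =
        (\<Sum>j\<le>m. of_nat (m choose j) * (a (Suc j) *
          (\<Sum>\<kappa>\<in>int_partitions (m - j). d_coeff \<kappa> * (\<phi> (Suc (size \<kappa>)) * (\<Prod>l\<in>#\<kappa>. a l)))))"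
      unfolding Suc field_scalars.partition_sum_recursion by (simp add: sum_distrib_left mult_ac)
    also have "\<dots> = (\<Sum>j\<le>m. of_nat (m choose j) * (a (Suc j) *
          (\<Sum>k\<le>N. \<phi> (Suc k) * reduced_power a k (m - j) / fact k)))"
      using less.prems Suc by (intro sum.cong refl) (subst less.IH[of _ "\<lambda>k. \<phi> (Suc k)"], auto)
    also have "\<dots> = (\<Sum>k\<le>N. \<Sum>j\<le>m. of_nat (m choose j) * (a (Suc j) *
          (\<phi> (Suc k) * reduced_power a k (m - j) / fact k)))"
      unfolding sum_distrib_left by (rule sum.swap)
    also have "\<dots> = (\<Sum>k\<le>N. \<phi> (Suc k) * reduced_power a (Suc k) i / fact (Suc k))"
    proof (intro sum.cong refl)
      fix k
      have "of_nat (Suc k) \<noteq> (0::'a)" unfolding of_nat_eq_0_iff by simp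
      hence "\<phi> (Suc k) * reduced_power a (Suc k) i / fact (Suc k) =
          (\<phi> (Suc k) / fact k) * (\<Sum>j\<le>m. of_nat (m choose j) * a (Suc j) * reduced_power a k (m - j))"
        unfolding Suc reduced_power_Suc_Suc by (simp del: of_nat_Suc)
      thus "(\<Sum>j\<le>m. of_nat (m choose j) * (a (Suc j) *
          (\<phi> (Suc k) * reduced_power a k (m - j) / fact k))) =
          \<phi> (Suc k) * reduced_power a (Suc k) i / fact (Suc k)"
        by (simp add: sum_distrib_left mult_ac)
    qed
    also have "\<dots> = (\<Sum>k\<le>Suc N. \<phi> k * reduced_power a k i / fact k)"
      by (subst sum.atMost_Suc_shift) (simp add: Suc)
    also have "\<dots> = (\<Sum>k\<le>N. \<phi> k * reduced_power a k i / fact k)"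
      using less.prems by (simp add: reduced_power_eq_0)
    finally show ?thesis .
  qed
qed

section \<open>Expectation of uncorrelated umbral polynomials\<close>

lemma poly_mapping_eq_sum_single:
  "p = (\<Sum>x\<in>Poly_Mapping.keys p. Poly_Mapping.single x (Poly_Mapping.lookup p x))"
  by (rule poly_mapping_eqI) (auto simp: lookup_sum lookup_single when_def in_keys_iff)

lemma umb_power: "umb \<alpha> ^ e = Poly_Mapping.single (Poly_Mapping.single \<alpha> e) 1"
  by (induction e) (simp_all add: umb_def mult_single flip: single_add)

lemma single_eq_Const_prod:
  "Poly_Mapping.single m c =
    Const c * (\<Prod>\<alpha>\<in>Poly_Mapping.keys m. umb \<alpha> ^ Poly_Mapping.lookup m \<alpha>)"
proof -
  have "(\<Prod>x\<in>S. Poly_Mapping.single (f x) 1) = Poly_Mapping.single (sum f S) (1::'b)"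
    if "finite S" for f :: "'a \<Rightarrow> 'a \<Rightarrow>\<^sub>0 nat" and S
    using that by (induction S rule: finite_induct) (simp_all add: mult_single)
  thus ?thesis
    by (simp add: umb_power Const_def mult_single flip: poly_mapping_eq_sum_single)
qed

lemma umbrae_in_umb: "umbrae_in (umb \<alpha> :: ('a, 'k::zero_neq_one) umbral_poly) = {\<alpha>}"
  by (simp add: umbrae_in_def umb_def)

lemma umbrae_in_add: "umbrae_in (p + q) \<subseteq> umbrae_in p \<union> umbrae_in q"
  using keys_add[of p q] by (auto simp: umbrae_in_def)

lemma umbrae_in_mult: "umbrae_in (p * q) \<subseteq> umbrae_in p \<union> umbrae_in q"
  unfolding umbrae_in_def using keys_mult[of p q] keys_add by fastforce

lemma umbrae_in_of_nat: "umbrae_in (of_nat m) = {}"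
  by (auto simp: umbrae_in_def simp flip: single_of_nat split: if_splits)

lemma umbrae_in_1: "umbrae_in 1 = {}"
  by (simp add: umbrae_in_def)

lemma umbrae_in_power: "umbrae_in (p ^ m) \<subseteq> umbrae_in p"
  by (induction m) (use umbrae_in_mult in \<open>fastforce simp: umbrae_in_1\<close>)+

lemma umbrae_in_sum: "umbrae_in (sum f S) \<subseteq> (\<Union>x\<in>S. umbrae_in (f x))"
proof (induction S rule: infinite_finite_induct)
  case (insert x S)
  thus ?case using umbrae_in_add[of "f x" "sum f S"] by auto
qed (auto simp: umbrae_in_def)

context umbral_calculus
begin

lemma E_zero: "E 0 = 0"
  using E_add[of 0 0] by simp

lemma E_sum: "E (sum f S) = (\<Sum>x\<in>S. E (f x))"
  by (induction S rule: infinite_finite_induct) (simp_all add: E_zero E_add)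

lemma E_of_nat_mult: "E (of_nat m * p) = of_nat m * E p"
  using E_scale[of "of_nat m" p] by (simp add: umbral_scalars.h_of_nat)

lemma E_single:
  "E (Poly_Mapping.single m c) =
    c * (\<Prod>\<alpha>\<in>Poly_Mapping.keys m. E (umb \<alpha> ^ Poly_Mapping.lookup m \<alpha>))"
  by (subst single_eq_Const_prod) (simp add: E_scale E_prod_distinct)

text \<open>
  By linearity this reduces to monomials, where the supports are disjoint and the product rule for
  distinct umbrae applies.
\<close>

lemma E_mult_uncorrelated:
  assumes "umbrae_in p \<inter> umbrae_in q = {}"
  shows "E (p * q) = E p * E q"
proof -
  let ?s = "\<lambda>p m. Poly_Mapping.single m (Poly_Mapping.lookup p m)"
  have mono: "E (?s p m * ?s q m') = E (?s p m) * E (?s q m')"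
    if "m \<in> Poly_Mapping.keys p" "m' \<in> Poly_Mapping.keys q" for m m'
  proof -
    have disj: "Poly_Mapping.keys m \<inter> Poly_Mapping.keys m' = {}"
      using assms that by (auto simp: umbrae_in_def)
    have "Poly_Mapping.keys (m + m') = Poly_Mapping.keys m \<union> Poly_Mapping.keys m'"
      by (auto simp: in_keys_iff lookup_add)
    moreover have "Poly_Mapping.lookup (m + m') \<alpha> = Poly_Mapping.lookup m \<alpha>"
      if "\<alpha> \<in> Poly_Mapping.keys m" for \<alpha>
      using that disj by (auto simp: lookup_add in_keys_iff)
    moreover have "Poly_Mapping.lookup (m + m') \<alpha> = Poly_Mapping.lookup m' \<alpha>"
      if "\<alpha> \<in> Poly_Mapping.keys m'" for \<alpha>
      using that disj by (auto simp: lookup_add in_keys_iff)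
    ultimately show ?thesis
      using disj by (simp add: mult_single E_single prod.union_disjoint)
  qed
  have "E (p * q) = E ((\<Sum>m\<in>Poly_Mapping.keys p. ?s p m) * (\<Sum>m'\<in>Poly_Mapping.keys q. ?s q m'))"
    by (simp flip: poly_mapping_eq_sum_single)
  also have "\<dots> = (\<Sum>m\<in>Poly_Mapping.keys p. \<Sum>m'\<in>Poly_Mapping.keys q. E (?s p m) * E (?s q m'))"
    unfolding sum_product E_sum by (intro sum.cong refl mono)
  also have "\<dots> = E (\<Sum>m\<in>Poly_Mapping.keys p. ?s p m) * E (\<Sum>m'\<in>Poly_Mapping.keys q. ?s q m')"
    by (simp only: sum_product E_sum)
  also have "\<dots> = E p * E q"
    by (simp flip: poly_mapping_eq_sum_single)
  finally show ?thesis .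
qed

lemma umbrae_in_mixture:
  "umbrae_in (mixture y (\<lambda>l. umb (\<alpha>s l)) n i) \<subseteq> umbrae_in y \<union> \<alpha>s ` {1..n}"
proof (induction n arbitrary: i)
  case 0
  show ?case by (simp add: umbrae_in_1 umbrae_in_def)
next
  case (Suc n)
  have "umbrae_in (of_nat (i choose j) * mixture y (\<lambda>l. umb (\<alpha>s l)) n j *
      (if j = i then 1 else y * umb (\<alpha>s (Suc n)) ^ (i - j))) \<subseteq> umbrae_in y \<union> \<alpha>s ` {1..Suc n}" for j
  proof -
    have "umbrae_in (if j = i then 1 else y * umb (\<alpha>s (Suc n)) ^ (i - j)) \<subseteq>
        umbrae_in y \<union> {\<alpha>s (Suc n)}"
      using umbrae_in_mult[of y "umb (\<alpha>s (Suc n)) ^ (i - j)"]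
        umbrae_in_power[of "umb (\<alpha>s (Suc n))" "i - j"]
      by (auto simp: umbrae_in_1 umbrae_in_umb)
    moreover have "umbrae_in (of_nat (i choose j) * mixture y (\<lambda>l. umb (\<alpha>s l)) n j) \<subseteq>
        umbrae_in y \<union> \<alpha>s ` {1..n}"
      using umbrae_in_mult[of "of_nat (i choose j)" "mixture y (\<lambda>l. umb (\<alpha>s l)) n j"] Suc[of j]
      by (auto simp: umbrae_in_of_nat)
    ultimately show ?thesis
      by (intro order.trans[OF umbrae_in_mult]) (auto simp: atLeastAtMostSuc_conv)
  qed
  thus ?case
    unfolding mixture.simps by (intro order.trans[OF umbrae_in_sum UN_least])
qed

text \<open>
  Taking the expectation in the \<open>\<alpha>\<^sub>l\<close> alone turns each factor \<open>1 + y (exp (\<alpha>\<^sub>l t) - 1)\<close> into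
  \<open>1 + y (f(t) - 1)\<close>, and the binomial theorem expands the \<open>n\<close>-th power in \<open>y\<close>. The factor \<open>y\<^sup>q\<close> is
  needed for the induction, because \<open>y\<close> stays common to all \<open>n\<close> factors and its powers accumulate.
\<close>

lemma E_mixture:
  assumes "\<And>l. l \<in> {1..n} \<Longrightarrow> \<alpha>s l \<notin> umbrae_in y" "inj_on \<alpha>s {1..n}"
    and "\<And>l j. l \<in> {1..n} \<Longrightarrow> E (umb (\<alpha>s l) ^ j) = a j"
  shows "E (y ^ q * mixture y (\<lambda>l. umb (\<alpha>s l)) n i) =
    (\<Sum>k\<le>n. of_nat (n choose k) * E (y ^ (q + k)) * reduced_power a k i)"
  using assms
proof (induction n arbitrary: q i)
  case 0
  show ?case by (simp add: E_zero)
next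
  case (Suc n)
  let ?Z = "mixture y (\<lambda>l. umb (\<alpha>s l)) n"
  let ?x = "umb (\<alpha>s (Suc n))"
  have new: "\<alpha>s (Suc n) \<notin> umbrae_in y \<union> \<alpha>s ` {1..n}"
  proof
    assume "\<alpha>s (Suc n) \<in> umbrae_in y \<union> \<alpha>s ` {1..n}"
    moreover have "\<alpha>s (Suc n) \<notin> umbrae_in y" using Suc.prems(1)[of "Suc n"] by simp
    ultimately obtain l where "l \<in> {1..n}" "\<alpha>s (Suc n) = \<alpha>s l" by auto
    thus False using inj_onD[OF Suc.prems(2), of "Suc n" l] by simp
  qed
  have IH: "E (y ^ q * ?Z j) =
      (\<Sum>k\<le>n. of_nat (n choose k) * E (y ^ (q + k)) * reduced_power a k j)" for q j
    using Suc.prems by (intro Suc.IH) (auto intro: inj_on_subset)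
  have indep: "E (y ^ q * ?Z j * ?x ^ m) = E (y ^ q * ?Z j) * a m" for q j m
  proof -
    have "umbrae_in (y ^ q * ?Z j) \<subseteq> umbrae_in y \<union> \<alpha>s ` {1..n}"
      using umbrae_in_mult[of "y ^ q" "?Z j"] umbrae_in_power[of y q] umbrae_in_mixture[of y \<alpha>s n j]
      by blast
    hence "umbrae_in (y ^ q * ?Z j) \<inter> umbrae_in (?x ^ m) = {}"
      using new umbrae_in_power[of ?x m] by (auto simp: umbrae_in_umb)
    thus ?thesis using Suc.prems(3)[of "Suc n" m] by (subst E_mult_uncorrelated) simp_all
  qed
  \<comment> \<open>Only the term \<open>j = i\<close>, the constant term of the new factor, carries no further \<open>y\<close>.\<close>
  have "y ^ q * mixture y (\<lambda>l. umb (\<alpha>s l)) (Suc n) i =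
      y ^ q * ?Z i + (\<Sum>j<i. of_nat (i choose j) * (y ^ Suc q * ?Z j * ?x ^ (i - j)))"
    by (simp add: lessThan_Suc_atMost[symmetric] sum_distrib_left algebra_simps)
  hence "E (y ^ q * mixture y (\<lambda>l. umb (\<alpha>s l)) (Suc n) i) =
      E (y ^ q * ?Z i) + (\<Sum>j<i. of_nat (i choose j) * (E (y ^ Suc q * ?Z j) * a (i - j)))"
    by (simp only: E_add E_sum E_of_nat_mult indep)
  also have "(\<Sum>j<i. of_nat (i choose j) * (E (y ^ Suc q * ?Z j) * a (i - j))) =
      (\<Sum>k\<le>n. of_nat (n choose k) * E (y ^ (q + Suc k)) * reduced_power a (Suc k) i)"
    unfolding IH sum_distrib_right sum_distrib_left reduced_power.simps
    by (subst sum.swap) (simp add: mult_ac)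
  also have "E (y ^ q * ?Z i) =
      (\<Sum>k\<le>Suc n. of_nat (n choose k) * E (y ^ (q + k)) * reduced_power a k i)"
    by (simp add: IH)
  also have "\<dots> = E (y ^ q) * reduced_power a 0 i +
      (\<Sum>k\<le>n. of_nat (n choose Suc k) * E (y ^ (q + Suc k)) * reduced_power a (Suc k) i)"
    by (subst sum.atMost_Suc_shift) simp
  also have "\<dots> + (\<Sum>k\<le>n. of_nat (n choose k) * E (y ^ (q + Suc k)) * reduced_power a (Suc k) i) =
      E (y ^ q) * reduced_power a 0 i +
      (\<Sum>k\<le>n. of_nat (Suc n choose Suc k) * E (y ^ (q + Suc k)) * reduced_power a (Suc k) i)"
    by (simp only: binomial_Suc_Suc of_nat_add distrib_right sum.distrib) (simp add: add_ac)
  also have "\<dots> = (\<Sum>k\<le>Suc n. of_nat (Suc n choose k) * E (y ^ (q + k)) * reduced_power a k i)"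
    by (subst sum.atMost_Suc_shift) simp
  finally show ?case .
qed

section \<open>Moments of the auxiliary umbrae\<close>

lemma singleton_moment:
  assumes "singleton_umbra E \<chi>"
  shows "E (umb \<chi> ^ j) = of_bool (j \<le> 1)"
  using assms E_one by (cases "j \<ge> 2") (auto simp: singleton_umbra_def not_le less_2_cases_iff)

text \<open>
  The expectation of a polynomial in \<open>\<chi>\<close> is the sum of its constant and its linear coefficient. For
  \<open>(x)\<^sub>m\<close> with \<open>m > 0\<close> the former is zero and the latter is \<open>(-1)(-2)\<cdots>(-(m - 1))\<close>.
\<close>

lemma E_lower_factorial_singleton:
  assumes "singleton_umbra E \<chi>" and "m > 0"
  shows "E (lower_factorial (umb \<chi>) m) = (-1) ^ (m - 1) * fact (m - 1)"
proof -
  \<comment> \<open>A power \<open>\<chi>\<^sup>j\<close> is carried along because the recursion of \<open>(\<chi>)\<^sub>m\<close> multiplies by \<open>\<chi> - m\<close>.\<close>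
  let ?L = "\<lambda>j m. E (umb \<chi> ^ j * lower_factorial (umb \<chi>) m)"
  have L_0: "?L j 0 = of_bool (j \<le> 1)" for j
    by (simp add: lower_factorial_def singleton_moment[OF assms(1)])
  have L_Suc: "?L j (Suc m) = ?L (Suc j) m - of_nat m * ?L j m" for j m
  proof -
    have "umb \<chi> ^ Suc j * lower_factorial (umb \<chi>) m =
        umb \<chi> ^ j * lower_factorial (umb \<chi>) (Suc m) +
        of_nat m * (umb \<chi> ^ j * lower_factorial (umb \<chi>) m)"
      by (simp add: lower_factorial_def algebra_simps)
    from arg_cong[OF this, of E] show ?thesis
      by (simp only: E_add E_of_nat_mult add_diff_cancel_right')
  qed
  have L_2: "?L j m = 0" if "j \<ge> 2" for j m
    using that by (induction m arbitrary: j) (simp_all add: L_0 L_Suc del: power_Suc)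
  have L_1: "?L 1 m = of_bool (m = 0)" for m
    by (induction m) (simp_all only: L_0 L_Suc L_2, auto)
  have "?L 0 (Suc m) = (-1) ^ m * fact m" for m
    by (induction m) (use L_1 in \<open>simp_all add: L_Suc L_0 del: power_0\<close>)
  from this[of "m - 1"] show ?thesis using \<open>m > 0\<close> by simp
qed

text \<open>
  The cumulants as coefficients of \<open>log f = \<Sum>\<^sub>k (-1)\<^bsup>k-1\<^esup> (f - 1)\<^sup>k / k\<close>, truncated at any \<open>N \<ge> i\<close>.
\<close>

lemma dot_singleton_moment:
  assumes "dot_umbra E \<delta> \<chi> \<alpha>" and "singleton_umbra E \<chi>" and "i \<ge> 1" and "i \<le> N"
  shows "E (umb \<delta> ^ i) =
    (\<Sum>k=1..N. (-1) ^ (k - 1) * fact (k - 1) * reduced_power (\<lambda>j. E (umb \<alpha> ^ j)) k i / fact k)"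
proof -
  let ?a = "\<lambda>j. E (umb \<alpha> ^ j)"
  let ?\<phi> = "\<lambda>k. E (lower_factorial (umb \<chi>) k)"
  have "E (umb \<delta> ^ i) = (\<Sum>\<mu>\<in>int_partitions i. d_coeff \<mu> * (?\<phi> (size \<mu>) * (\<Prod>j\<in>#\<mu>. ?a j)))"
    using assms(1) by (simp add: dot_umbra_def image_prod_mset_multiplicity mult_ac)
  also have "\<dots> = (\<Sum>k\<le>N. ?\<phi> k * reduced_power ?a k i / fact k)"
    by (rule weighted_partition_sum) fact
  also have "\<dots> = (\<Sum>k=1..N. ?\<phi> k * reduced_power ?a k i / fact k)"
    by (rule sum.mono_neutral_right) (use assms(3) in \<open>auto simp: not_le\<close>)
  finally show ?thesis
    using assms(2) by (simp add: E_lower_factorial_singleton)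
qed

text \<open>
  For \<open>\<alpha> = \<chi>\<close> one has \<open>f - 1 = t\<close>, so only \<open>(f - 1)\<^sup>k\<close> has a coefficient at \<open>t\<^sup>k\<close>.
\<close>

lemma dot_singleton_singleton_moment:
  assumes "dot_umbra E \<delta> \<chi> \<chi>" and "singleton_umbra E \<chi>" and "k \<ge> 1"
  shows "E (umb \<delta> ^ k) = (-1) ^ (k - 1) * fact (k - 1)"
proof -
  let ?a = "\<lambda>j. E (umb \<chi> ^ j)"
  have "field_scalars.egf (\<lambda>i. if i = 0 then 0 else ?a i) = fps_X"
    using singleton_moment[OF assms(2), of 1]
    by (auto simp: fps_eq_iff field_scalars.egf_nth singleton_moment[OF assms(2)])
  hence "fps_nth (field_scalars.egf (reduced_power ?a j)) k = of_bool (k = j)" for j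
    by (simp add: egf_reduced_power)
  hence G: "reduced_power ?a j k = fact k * of_bool (k = j)" for j
    by (simp add: field_scalars.egf_nth field_simps split: if_splits)
  have "E (umb \<delta> ^ k) =
      (\<Sum>j=1..k. (-1) ^ (j - 1) * fact (j - 1) * reduced_power ?a j k / fact j)"
    using assms by (intro dot_singleton_moment) auto
  also have "\<dots> = (\<Sum>j=1..k. if k = j then (-1) ^ (j - 1) * fact (j - 1) else 0)"
    by (intro sum.cong) (auto simp: G)
  also have "\<dots> = (-1) ^ (k - 1) * fact (k - 1)" using assms(3) by simp
  finally show ?thesis .
qed

text \<open>
  The moment is \<open>(n)\<^sub>k\<close>, written as \<open>k!\<close> times a binomial coefficient. As \<open>x\<^sup>2\<close> and higher powers of the
  new singleton \<open>x\<close> have expectation zero, \<open>(q + x)\<^sup>k\<close> reduces to \<open>q\<^sup>k + k q\<^bsup>k-1\<^esup>\<close>, and Pascal's rule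
  does the rest.
\<close>

lemma sum_singletons_moment:
  assumes "\<And>l j. l \<in> {1..n} \<Longrightarrow> E (umb (\<chi>s l) ^ j) = of_bool (j \<le> 1)" "inj_on \<chi>s {1..n}"
  shows "E ((\<Sum>l=1..n. umb (\<chi>s l)) ^ k) = fact k * of_nat (n choose k)"
  using assms
proof (induction n arbitrary: k)
  case 0
  show ?case by (cases k) (simp_all add: E_zero E_one)
next
  case (Suc n)
  let ?q = "\<Sum>l=1..n. umb (\<chi>s l) :: ('a, 'k) umbral_poly" and ?x = "umb (\<chi>s (Suc n))"
  have IH: "E (?q ^ j) = fact j * of_nat (n choose j)" for j
    using Suc.prems by (intro Suc.IH) (auto intro: inj_on_subset)
  have indep: "E (?q ^ j * ?x ^ m) = E (?q ^ j) * of_bool (m \<le> 1)" for j m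
  proof -
    have "\<chi>s (Suc n) \<notin> \<chi>s ` {1..n}"
    proof
      assume "\<chi>s (Suc n) \<in> \<chi>s ` {1..n}"
      then obtain l where "l \<in> {1..n}" "\<chi>s (Suc n) = \<chi>s l" by auto
      thus False using inj_onD[OF Suc.prems(2), of "Suc n" l] by simp
    qed
    moreover have "umbrae_in ?q \<subseteq> \<chi>s ` {1..n}"
      using umbrae_in_sum[of "\<lambda>l. umb (\<chi>s l)" "{1..n}"] by (auto simp: umbrae_in_umb)
    ultimately have "umbrae_in (?q ^ j) \<inter> umbrae_in (?x ^ m) = {}"
      using umbrae_in_power[of ?x m] umbrae_in_power[of ?q j] by (auto simp: umbrae_in_umb)
    thus ?thesis using Suc.prems(1)[of "Suc n" m] by (subst E_mult_uncorrelated) simp_all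
  qed
  show ?case
  proof (cases k)
    case (Suc m)
    have "E ((?q + ?x) ^ k) = (\<Sum>j\<le>k. of_nat (k choose j) * (E (?q ^ j) * of_bool (k - j \<le> 1)))"
      by (simp only: binomial_ring E_sum mult.assoc E_of_nat_mult indep)
    also have "\<dots> = (\<Sum>j\<in>{m, Suc m}. of_nat (k choose j) * (E (?q ^ j) * of_bool (k - j \<le> 1)))"
      by (rule sum.mono_neutral_right) (auto simp: Suc)
    also have "\<dots> = fact k * of_nat (Suc n choose k)"
      unfolding IH by (simp add: Suc algebra_simps)
    finally show ?thesis by simp
  qed (simp add: E_one)
qed

lemma similar_moment: "similar E (umb \<beta>) (umb \<alpha>) \<Longrightarrow> E (umb \<beta> ^ j) = E (umb \<alpha> ^ j)"
  by (simp add: similar_def umbral_equiv_def)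

lemma uncorrelated_copies_inj:
  "uncorrelated_copies E n \<alpha> \<alpha>s \<Longrightarrow> inj_on \<alpha>s {1..n}"
  by (auto simp: inj_on_def uncorrelated_copies_def uncorrelated_def umbrae_in_umb)

lemma inverse_moment:
  assumes "singleton_umbra E \<chi>" "uncorrelated_copies E n \<chi> \<chi>s"
    and "inverse_umbra E \<beta> (power_sum n \<chi>s 1)" and "k \<le> n"
  shows "E (umb \<beta> ^ k) = 1 / (fact k * of_nat (n choose k))"
proof -
  have "E (power_sum n \<chi>s 1 ^ k) = fact k * of_nat (n choose k)"
    unfolding power_sum_def power_one_right
  proof (rule sum_singletons_moment)
    fix l j assume "l \<in> {1..n}"
    hence "similar E (umb (\<chi>s l)) (umb \<chi>)" using assms(2) by (simp add: uncorrelated_copies_def)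
    thus "E (umb (\<chi>s l) ^ j) = of_bool (j \<le> 1)"
      using singleton_moment[OF assms(1)] by (simp only: similar_moment)
  qed (rule uncorrelated_copies_inj[OF assms(2)])
  moreover have "\<dots> \<noteq> (0::'k)" using assms(4) by simp
  ultimately show ?thesis using assms(3) by (simp add: inverse_umbra_def)
qed

end

section \<open>The cumulant formula\<close>

theorem theorem7p3:
  fixes E :: "('a, 'k::field_char_0) umbral_poly \<Rightarrow> 'k"
    and \<alpha> \<chi> \<chi>_dot_\<alpha> \<chi>_dot_\<chi> inv_n_dot_\<chi> :: 'a
    and \<alpha>s \<chi>s :: "nat \<Rightarrow> 'a"
    and n i :: nat
  assumes "umbral_calculus E"
    and "singleton_umbra E \<chi>"
    and "n > 0" and "1 \<le> i" and "i \<le> n"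
    and "dot_umbra E \<chi>_dot_\<alpha> \<chi> \<alpha>"
    and "dot_umbra E \<chi>_dot_\<chi> \<chi> \<chi>"
    and "uncorrelated_copies E n \<chi> \<chi>s"
    and "inverse_umbra E inv_n_dot_\<chi> (power_sum n \<chi>s 1)"
    and "uncorrelated (umb \<chi>_dot_\<chi> :: ('a, 'k) umbral_poly) (umb inv_n_dot_\<chi>)"
    and "uncorrelated_copies E n \<alpha> \<alpha>s"
    and "\<forall>l\<in>{1..n}. uncorrelated
           (umb \<chi>_dot_\<chi> * umb inv_n_dot_\<chi> :: ('a, 'k) umbral_poly) (umb (\<alpha>s l))"
  shows "umbral_equiv E (umb \<chi>_dot_\<alpha> ^ i)
           (\<Sum>\<mu>\<in>int_partitions i.
              Const (d_coeff \<mu>) *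
              subst_umbral (p_partition \<mu>) (umb \<chi>_dot_\<chi> * umb inv_n_dot_\<chi>) *
              (\<Prod>j\<in>set_mset \<mu>. power_sum n \<alpha>s j ^ count \<mu> j))"
proof -
  interpret umbral_calculus E by fact
  let ?y = "umb \<chi>_dot_\<chi> * umb inv_n_dot_\<chi> :: ('a, 'k) umbral_poly"
  let ?a = "\<lambda>j. E (umb \<alpha> ^ j)"
  \<comment> \<open>The binomial coefficient of the expansion cancels the one in \<open>1 / (n)\<^sub>k\<close>, leaving \<open>1 / k!\<close>.\<close>
  have y_moment: "of_nat (n choose k) * E (?y ^ k) = (-1) ^ (k - 1) * fact (k - 1) / fact k"
    if "k \<in> {1..n}" for k
  proof -
    have "umbrae_in (umb \<chi>_dot_\<chi> ^ k :: ('a, 'k) umbral_poly) \<inter>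
        umbrae_in (umb inv_n_dot_\<chi> ^ k :: ('a, 'k) umbral_poly) = {}"
      using assms(10) umbrae_in_power[of "umb \<chi>_dot_\<chi> :: ('a, 'k) umbral_poly" k]
        umbrae_in_power[of "umb inv_n_dot_\<chi> :: ('a, 'k) umbral_poly" k]
      by (auto simp: uncorrelated_def)
    hence "E (?y ^ k) = E (umb \<chi>_dot_\<chi> ^ k) * E (umb inv_n_dot_\<chi> ^ k)"
      by (simp add: power_mult_distrib E_mult_uncorrelated)
    thus ?thesis
      using that dot_singleton_singleton_moment[OF assms(7) assms(2), of k]
        inverse_moment[OF assms(2) assms(8) assms(9), of k]
      by simp
  qed
  have "E (\<Sum>\<mu>\<in>int_partitions i. Const (d_coeff \<mu>) * subst_umbral (p_partition \<mu>) ?y *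
      (\<Prod>j\<in>set_mset \<mu>. power_sum n \<alpha>s j ^ count \<mu> j)) =
      E (?y ^ 0 * mixture ?y (\<lambda>l. umb (\<alpha>s l)) n i)"
    unfolding umbral_sum_eq_bell bell_p_poly_power_sum by simp
  also have "\<dots> = (\<Sum>k\<le>n. of_nat (n choose k) * E (?y ^ (0 + k)) * reduced_power ?a k i)"
    using assms(11,12) uncorrelated_copies_inj[OF assms(11)]
    by (intro E_mixture)
      (auto simp: uncorrelated_copies_def similar_moment uncorrelated_def umbrae_in_umb)
  also have "\<dots> = (\<Sum>k=1..n. of_nat (n choose k) * E (?y ^ k) * reduced_power ?a k i)"
    by (rule sum.mono_neutral_cong_right) (use assms(4) in \<open>auto simp: not_le\<close>)
  also have "\<dots> = E (umb \<chi>_dot_\<alpha> ^ i)"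
    unfolding dot_singleton_moment[OF assms(6,2,4,5)] by (intro sum.cong) (simp_all add: y_moment)
  finally show ?thesis by (simp add: umbral_equiv_def)
qed

end
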